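(* Let $n\ge4$, $1\le j\le\lfloor n/2\rfloor$, $G=C_n(\{1,\dots,\lfloor n/2\rfloor\}\setminus\{j\})$ and $k=n/\gcd(n,j)$. Then (i) $\nu(G)=2$ if $k=4$ and $\nu(G)=1$ otherwise; (ii) $G$ is well-covered and Buchsbaum; (iii) $G$ is vertex decomposable (respectively shellable, Cohen–Macaulay, sequentially Cohen–Macaulay, $S_2$) if and only if $\gcd(n,j)=1$.
   Context: The circulant graph $C_n(S)$ ($S\subseteq\{1,\dots,\lfloor n/2\rfloor\}$) has vertex set $\{0,\dots,n-1\}$ with $\{a,b\}$ an edge iff $\min(|a-b|,n-|a-b|)\in S$. Fix a field $\mathbb{K}$. $\Delta_G$ is the independence complex of $G$. $G$ is well-covered if all maximal independent sets have the same cardinality. $\nu(G)$ is the maximum number of edges in an induced matching (pairwise disjoint edges such that the induced subgraph on their endpoints has exactly these edges). For a face $F$, $\mathrm{lk}(F)=\{H\in\Delta:H\cap F=\emptyset,H\cup F\in\Delta\}$, $\mathrm{del}(F)=\{H\in\Delta:H\cap F=\emptyset\}$. $G$ is Cohen–Macaulay if $\widetilde H_i(\mathrm{lk}_{\Delta_G}(F);\mathbb{K})=0$ for every face $F$ and $i<\dim\mathrm{lk}_{\Delta_G}(F)$; Buchsbaum if $G\setminus N_G[x]$ is Cohen–Macaulay for every vertex $x$; $S_2$ if $\mathrm{lk}_{\Delta_G}(F)$ is connected for every face $F$ with $\dim\mathrm{lk}_{\Delta_G}(F)\ge1$; sequentially Cohen–Macaulay if each pure $i$-th skeleton of $\Delta_G$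 (generated by the $i$-dimensional faces) is Cohen–Macaulay. A pure complex is vertex decomposable if it is a simplex or has a vertex $x$ with $\mathrm{lk}(x)$, $\mathrm{del}(x)$ vertex decomposable; shellable if pure with a facet order $F_1<\dots<F_r$ such that for all $j<i$ there are $x\in F_i\setminus F_j$ and $k<i$ with $F_i\setminus F_k=\{x\}$. $G$ has a property when $\Delta_G$ does. *)

theory Defs
  imports Main
begin

section \<open>Circulant graphs and independence complexes\<close>

text \<open>A graph is given by a finite vertex set V and a (symmetric, irreflexive)
adjacency relation E. A simplicial complex is a set of finite vertex sets.\<close>

definition circ_adj :: "nat \<Rightarrow> nat set \<Rightarrow> nat \<Rightarrow> nat \<Rightarrow> bool" where
  "circ_adj n S a b \<longleftrightarrow> a < n \<and> b < n \<and>
     (let d = (if a \<le> b then b - a else a - b) in min d (n - d) \<in> S)"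

definition ind_complex :: "nat set \<Rightarrow> (nat \<Rightarrow> nat \<Rightarrow> bool) \<Rightarrow> nat set set" where
  "ind_complex V E = {I. I \<subseteq> V \<and> (\<forall>a\<in>I. \<forall>b\<in>I. \<not> E a b)}"

definition facets :: "nat set set \<Rightarrow> nat set set" where
  "facets \<Delta> = {F \<in> \<Delta>. \<forall>H\<in>\<Delta>. F \<subseteq> H \<longrightarrow> H = F}"

definition well_covered :: "nat set \<Rightarrow> (nat \<Rightarrow> nat \<Rightarrow> bool) \<Rightarrow> bool" where
  "well_covered V E \<longleftrightarrow>
     (\<forall>I\<in>facets (ind_complex V E). \<forall>J\<in>facets (ind_complex V E). card I = card J)"

definition induced_matching :: "nat set \<Rightarrow> (nat \<Rightarrow> nat \<Rightarrow> bool) \<Rightarrow> nat set set \<Rightarrow> bool" where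
  "induced_matching V E M \<longleftrightarrow>
     (\<forall>e\<in>M. \<exists>a b. e = {a, b} \<and> a \<in> V \<and> b \<in> V \<and> E a b) \<and>
     (\<forall>e\<in>M. \<forall>f\<in>M. e \<noteq> f \<longrightarrow> e \<inter> f = {}) \<and>
     (\<forall>a\<in>\<Union>M. \<forall>b\<in>\<Union>M. E a b \<longrightarrow> {a, b} \<in> M)"

definition induced_matching_number :: "nat set \<Rightarrow> (nat \<Rightarrow> nat \<Rightarrow> bool) \<Rightarrow> nat" where
  "induced_matching_number V E = Max {card M | M. induced_matching V E M}"

section \<open>Links, deletions, dimension\<close>

definition lk :: "nat set set \<Rightarrow> nat set \<Rightarrow> nat set set" where
  "lk \<Delta> F = {H \<in> \<Delta>. H \<inter> F = {} \<and> H \<union> F \<in> \<Delta>}"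

definition del :: "nat set set \<Rightarrow> nat set \<Rightarrow> nat set set" where
  "del \<Delta> F = {H \<in> \<Delta>. H \<inter> F = {}}"

definition cdim :: "nat set set \<Rightarrow> int" where
  "cdim \<Delta> = int (Max (card ` \<Delta>)) - 1"

section \<open>Reduced simplicial homology over a field (augmented oriented chain complex)\<close>

text \<open>Faces are oriented by the natural order of the vertices. A chain is a
finitely supported function from faces to the field. The boundary of a chain c
evaluated at the face G is the sum over v with G \<union> {v} a face of
(-1)^(number of vertices of G below v) * c (G \<union> {v}). The empty face is the
face in degree -1 (augmentation).\<close>

definition bd :: "nat set set \<Rightarrow> (nat set \<Rightarrow> 'k::comm_ring_1) \<Rightarrow> nat set \<Rightarrow> 'k" where
  "bd \<Delta> c G = (\<Sum>v\<in>{v \<in> \<Union>\<Delta>. v \<notin> G \<and> insert v G \<in> \<Delta>}.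
                  (-1) ^ card {u \<in> G. u < v} * c (insert v G))"

text \<open>rhom_zero K \<Delta> i: the reduced homology group in degree i of \<Delta> with
coefficients in the field of type 'k vanishes (every i-cycle is an i-boundary).\<close>

definition rhom_zero :: "'k::field itself \<Rightarrow> nat set set \<Rightarrow> int \<Rightarrow> bool" where
  "rhom_zero K \<Delta> i \<longleftrightarrow> i < -1 \<or>
     (\<forall>c :: nat set \<Rightarrow> 'k.
        ((\<forall>F. c F \<noteq> 0 \<longrightarrow> F \<in> \<Delta> \<and> int (card F) = i + 1) \<and>
         (\<forall>G\<in>\<Delta>. int (card G) = i \<longrightarrow> bd \<Delta> c G = 0)) \<longrightarrow>
        (\<exists>d :: nat set \<Rightarrow> 'k.
           (\<forall>F. d F \<noteq> 0 \<longrightarrow> F \<in> \<Delta> \<and> int (card F) = i + 2) \<and>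
           (\<forall>G\<in>\<Delta>. int (card G) = i + 1 \<longrightarrow> bd \<Delta> d G = c G)))"

section \<open>Properties of complexes\<close>

definition cohen_macaulay :: "'k::field itself \<Rightarrow> nat set set \<Rightarrow> bool" where
  "cohen_macaulay K \<Delta> \<longleftrightarrow>
     (\<forall>F\<in>\<Delta>. \<forall>i::int. i < cdim (lk \<Delta> F) \<longrightarrow> rhom_zero K (lk \<Delta> F) i)"

text \<open>Pure i-th skeleton, indexed by cardinality: generated by the faces with
exactly i vertices (i.e. of dimension i - 1).\<close>

definition pure_skeleton :: "nat set set \<Rightarrow> nat \<Rightarrow> nat set set" where
  "pure_skeleton \<Delta> i = {F. \<exists>H\<in>\<Delta>. card H = i \<and> F \<subseteq> H}"

definition seq_cohen_macaulay :: "'k::field itself \<Rightarrow> nat set set \<Rightarrow> bool" where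
  "seq_cohen_macaulay K \<Delta> \<longleftrightarrow> (\<forall>i::nat. cohen_macaulay K (pure_skeleton \<Delta> i))"

text \<open>Connectedness of a complex: its 1-skeleton (graph on its vertices) is connected.\<close>

definition complex_connected :: "nat set set \<Rightarrow> bool" where
  "complex_connected \<Delta> \<longleftrightarrow>
     (\<forall>u\<in>\<Union>\<Delta>. \<forall>v\<in>\<Union>\<Delta>. (u, v) \<in> {(a, b). {a, b} \<in> \<Delta>}\<^sup>*)"

definition S2 :: "nat set set \<Rightarrow> bool" where
  "S2 \<Delta> \<longleftrightarrow> (\<forall>F\<in>\<Delta>. cdim (lk \<Delta> F) \<ge> 1 \<longrightarrow> complex_connected (lk \<Delta> F))"

definition pure :: "nat set set \<Rightarrow> bool" where
  "pure \<Delta> \<longleftrightarrow> (\<forall>F\<in>facets \<Delta>. \<forall>H\<in>facets \<Delta>. card F = card H)"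

inductive vertex_decomposable :: "nat set set \<Rightarrow> bool" where
  simplex: "finite F \<Longrightarrow> vertex_decomposable (Pow F)"
| step: "pure \<Delta> \<Longrightarrow> x \<in> \<Union>\<Delta> \<Longrightarrow> vertex_decomposable (lk \<Delta> {x}) \<Longrightarrow>
         vertex_decomposable (del \<Delta> {x}) \<Longrightarrow> vertex_decomposable \<Delta>"

definition shellable :: "nat set set \<Rightarrow> bool" where
  "shellable \<Delta> \<longleftrightarrow> pure \<Delta> \<and>
     (\<exists>fs. distinct fs \<and> set fs = facets \<Delta> \<and>
        (\<forall>i<length fs. \<forall>j<i. \<exists>x \<in> fs ! i - fs ! j. \<exists>k<i. fs ! i - fs ! k = {x}))"

section \<open>Graph versions\<close>

definition buchsbaum_graph :: "'k::field itself \<Rightarrow> nat set \<Rightarrow> (nat \<Rightarrow> nat \<Rightarrow> bool) \<Rightarrow> bool" where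
  "buchsbaum_graph K V E \<longleftrightarrow>
     (\<forall>x\<in>V. cohen_macaulay K (ind_complex (V - ({x} \<union> {y \<in> V. E x y})) E))"

end

theory Submission
  imports Defs "HOL-Number_Theory.Cong"
begin

text \<open>Two distinct vertices are non-adjacent in the graph iff they differ by j modulo n, so the
complement of the graph is a disjoint union of gcd(n,j) cycles of length k = n / gcd(n,j) (single
edges if k = 2), and the independence complex is its clique complex. It has dimension one, unless
k = 3 (that is, n = 3j), when it is a disjoint union of triangles. If gcd(n,j) = 1, the complex
is a single n-cycle, which is vertex decomposable and shellable, and Cohen-Macaulayness of a
one-dimensional complex amounts to connectedness. Conversely, each of the five properties forces the
complex, or its pure 1-skeleton, to be connected, whereas the residue modulo gcd(n,j) is
constant on faces. Induced matchings of size two in the graph are induced 4-cycles of the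
complement.\<close>

text \<open>Only reduced homology in degrees -1 and 0 is ever computed. Wherever Cohen-Macaulayness
  has to be established, the complex has dimension at most one: for the Buchsbaum property because a
  vertex x has, besides itself, only x + j and x - j as non-neighbours, and for gcd(n,j) = 1 because
  n = 3 * j would then force j = 1 and n = 3, against n \<ge> 4. The two-dimensional case thus lives
  on the disconnected side, where degree 0 at the empty face already refutes the property. Hence the
  converse lemmas ask only that facets have at least two vertices, which admits triangles too. The
  bound j \<le> n / 2 makes the special orders explicit: writing n = g * k and j = g * m with m
  prime to k, it leaves only m = 1 for k = 3 and k = 4, that is, n = 3 * j and n = 4 * j. Statements
  about cycles of the complement so become linear arithmetic in n and j.\<close>

definition simplicial_complex :: "nat set set \<Rightarrow> bool" where
  "simplicial_complex \<Delta> \<longleftrightarrow> finite (\<Union>\<Delta>) \<and> (\<forall>F\<in>\<Delta>. \<forall>G\<subseteq>F. G \<in> \<Delta>)"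

section \<open>Closure of simplicial complexes under links, deletions and skeleta\<close>

lemma simplicial_complex_subset:
  "simplicial_complex \<Delta> \<Longrightarrow> F \<in> \<Delta> \<Longrightarrow> G \<subseteq> F \<Longrightarrow> G \<in> \<Delta>"
  unfolding simplicial_complex_def by blast

lemma simplicial_complex_finite_vertices: "simplicial_complex \<Delta> \<Longrightarrow> finite (\<Union>\<Delta>)"
  unfolding simplicial_complex_def by blast

lemma simplicial_complex_finite: "simplicial_complex \<Delta> \<Longrightarrow> finite \<Delta>"
  unfolding simplicial_complex_def by (metis finite_UnionD)

lemma simplicial_complex_finite_face:
  "simplicial_complex \<Delta> \<Longrightarrow> F \<in> \<Delta> \<Longrightarrow> finite F"
  unfolding simplicial_complex_def by (meson Union_upper finite_subset)

lemma simplicial_complex_lk: "simplicial_complex \<Delta> \<Longrightarrow> simplicial_complex (lk \<Delta> F)"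
proof -
  assume c: "simplicial_complex \<Delta>"
  have "finite (\<Union>(lk \<Delta> F))"
    by (rule finite_subset[OF _ simplicial_complex_finite_vertices[OF c]]) (auto simp: lk_def)
  moreover have "G \<in> lk \<Delta> F" if "H \<in> lk \<Delta> F" "G \<subseteq> H" for H G
  proof -
    have "G \<in> \<Delta>" "G \<union> F \<in> \<Delta>" "G \<inter> F = {}"
      using that simplicial_complex_subset[OF c, of H G]
        simplicial_complex_subset[OF c, of "H \<union> F" "G \<union> F"] by (auto simp: lk_def)
    then show ?thesis by (simp add: lk_def)
  qed
  ultimately show ?thesis by (simp add: simplicial_complex_def)
qed

lemma simplicial_complex_del: "simplicial_complex \<Delta> \<Longrightarrow> simplicial_complex (del \<Delta> F)"
proof -
  assume c: "simplicial_complex \<Delta>"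
  have "finite (\<Union>(del \<Delta> F))"
    by (rule finite_subset[OF _ simplicial_complex_finite_vertices[OF c]]) (auto simp: del_def)
  with c show ?thesis by (fastforce simp: del_def simplicial_complex_def)
qed

lemma simplicial_complex_pure_skeleton:
  "simplicial_complex \<Delta> \<Longrightarrow> simplicial_complex (pure_skeleton \<Delta> i)"
proof -
  assume c: "simplicial_complex \<Delta>"
  have "finite (\<Union>(pure_skeleton \<Delta> i))"
    by (rule finite_subset[OF _ simplicial_complex_finite_vertices[OF c]])
      (auto simp: pure_skeleton_def)
  then show ?thesis by (fastforce simp: pure_skeleton_def simplicial_complex_def)
qed

lemma simplicial_complex_ind_complex: "finite V \<Longrightarrow> simplicial_complex (ind_complex V E)"
proof -
  assume "finite V"
  then have "finite (\<Union>(ind_complex V E))"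
    by (rule finite_subset[rotated]) (auto simp: ind_complex_def)
  moreover have "G \<in> ind_complex V E" if "F \<in> ind_complex V E" "G \<subseteq> F" for F G
    using that unfolding ind_complex_def by blast
  ultimately show ?thesis by (simp add: simplicial_complex_def)
qed

lemma lk_empty: "lk \<Delta> {} = \<Delta>"
  by (simp add: lk_def)

lemma face_in_facet:
  assumes "simplicial_complex \<Delta>" "F \<in> \<Delta>"
  obtains H where "H \<in> facets \<Delta>" "F \<subseteq> H"
proof -
  obtain H where "H \<in> \<Delta>" "F \<subseteq> H" "\<forall>G\<in>\<Delta>. H \<subseteq> G \<longrightarrow> G = H"
    using finite_has_maximal2[OF simplicial_complex_finite[OF assms(1)] assms(2)] by metis
  then show thesis using that by (auto simp: facets_def)
qed

text \<open>Replaces the maximum in \<open>cdim\<close> by a witness face. The void complex is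
  excluded because \<open>Max\<close> of the empty set is unspecified; it does occur, as a pure
  skeleton above the dimension.\<close>

lemma cdim_less_iff:
  assumes "simplicial_complex \<Delta>" "\<Delta> \<noteq> {}"
  shows "i < cdim \<Delta> \<longleftrightarrow> (\<exists>F\<in>\<Delta>. i + 1 < int (card F))"
proof -
  have fin: "finite (card ` \<Delta>)" and ne: "card ` \<Delta> \<noteq> {}"
    using simplicial_complex_finite[OF assms(1)] assms(2) by auto
  obtain H where H: "H \<in> \<Delta>" "Max (card ` \<Delta>) = card H" using Max_in[OF fin ne] by blast
  have "card F \<le> card H" if "F \<in> \<Delta>" for F
    using Max_ge[OF fin, of "card F"] that H(2) by simp
  then show ?thesis unfolding cdim_def H(2) using H(1) by (smt (verit) of_nat_mono)
qed

lemma card_ge_1_obtain_vertex: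
  assumes "simplicial_complex \<Delta>" "F \<in> \<Delta>" "card F \<ge> 1"
  obtains v where "{v} \<in> \<Delta>"
proof -
  have "F \<noteq> {}" using assms(3) by auto
  then obtain v where "v \<in> F" by blast
  then show thesis using simplicial_complex_subset[OF assms(1,2), of "{v}"] that by blast
qed

section \<open>Connectedness and reduced homology in low degrees\<close>

abbreviation edge_rel :: "nat set set \<Rightarrow> (nat \<times> nat) set" where
  "edge_rel \<Delta> \<equiv> {(a, b). {a, b} \<in> \<Delta>}"

lemma edge_rel_rtrancl_sym: "(a, b) \<in> (edge_rel \<Delta>)\<^sup>* \<Longrightarrow> (b, a) \<in> (edge_rel \<Delta>)\<^sup>*"
proof -
  have "sym (edge_rel \<Delta>)" by (auto intro!: symI simp: insert_commute)
  then show "(a, b) \<in> (edge_rel \<Delta>)\<^sup>* \<Longrightarrow> (b, a) \<in> (edge_rel \<Delta>)\<^sup>*"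
    by (rule symD[OF sym_rtrancl])
qed

lemma complex_connectedI:
  assumes "\<And>v. v \<in> \<Union>\<Delta> \<Longrightarrow> (u, v) \<in> (edge_rel \<Delta>)\<^sup>*"
  shows "complex_connected \<Delta>"
  unfolding complex_connected_def
proof (intro ballI)
  fix v w assume "v \<in> \<Union>\<Delta>" "w \<in> \<Union>\<Delta>"
  then show "(v, w) \<in> (edge_rel \<Delta>)\<^sup>*"
    using assms edge_rel_rtrancl_sym[of u v \<Delta>] by (meson rtrancl_trans)
qed

lemma connected_constant:
  assumes "complex_connected \<Delta>" "u \<in> \<Union>\<Delta>" "v \<in> \<Union>\<Delta>"
    and "\<And>a b. {a, b} \<in> \<Delta> \<Longrightarrow> f a = f b"
  shows "f u = f v"
proof -
  have "(u, v) \<in> (edge_rel \<Delta>)\<^sup>*"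
    using assms(1-3) unfolding complex_connected_def by blast
  then show ?thesis by (induction rule: rtrancl_induct) (use assms(4) in auto)
qed

text \<open>In this sign convention the edge {a, b} with a < b has boundary b - a.\<close>

lemma bd_singleton:
  "bd \<Delta> c {w} =
    (\<Sum>x\<in>{x \<in> \<Union>\<Delta>. x \<noteq> w \<and> {x, w} \<in> \<Delta>}. (if w < x then - c {x, w} else c {x, w}))"
proof -
  have "{u \<in> {w}. u < x} = (if w < x then {w} else {})" for x by auto
  then show ?thesis unfolding bd_def by (intro sum.cong) auto
qed

lemma bd_empty:
  assumes "simplicial_complex \<Delta>"
  shows "bd \<Delta> c {} = (\<Sum>v\<in>\<Union>\<Delta>. c {v})"
  unfolding bd_def
  by (rule sum.cong) (auto intro: simplicial_complex_subset[OF assms])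

text \<open>Swapping coordinates only shows that the sum equals its own negative, which says nothing
  in characteristic 2. Splitting the pairs by x < y and y < x cancels them term by term over every
  field.\<close>

lemma sum_antisymmetric:
  fixes g :: "nat \<Rightarrow> nat \<Rightarrow> 'a::ab_group_add"
  assumes "finite P" "sym P" "irrefl P" "\<And>x y. (x, y) \<in> P \<Longrightarrow> g y x = - g x y"
  shows "(\<Sum>(x, y)\<in>P. g x y) = 0"
proof -
  define A where "A = {(x, y) \<in> P. x < y}"
  define B where "B = {(x, y) \<in> P. y < x}"
  have P: "P = A \<union> B" "A \<inter> B = {}"
    using assms(3) by (auto simp: A_def B_def irrefl_def) (metis linorder_neqE_nat)
  have fin: "finite A" "finite B" using assms(1) P by auto
  have "B = prod.swap ` A"
    using assms(2) by (auto simp: A_def B_def sym_def image_iff)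
  then have "(\<Sum>(x, y)\<in>B. g x y) = (\<Sum>(x, y)\<in>A. g y x)"
    by (simp add: sum.reindex case_prod_unfold)
  also have "\<dots> = (\<Sum>(x, y)\<in>A. - g x y)"
    by (rule sum.cong) (auto simp: A_def assms(4))
  finally show ?thesis
    using sum.union_disjoint[OF fin P(2), of "\<lambda>(x, y). g x y"] P(1)
    by (simp add: case_prod_unfold sum_negf)
qed

text \<open>If u and v lay in different components, the cycle u - v would bound some 1-chain d.
  Summed over the component of u, the boundary of d vanishes, since each edge inside contributes
  once with each sign, whereas u - v sums to 1.\<close>

lemma rhom_zero_0_imp_connected:
  fixes K :: "'k::field itself"
  assumes \<Delta>: "simplicial_complex \<Delta>" and van: "rhom_zero K \<Delta> 0"
  shows "complex_connected \<Delta>"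
proof (rule ccontr)
  assume "\<not> complex_connected \<Delta>"
  then obtain u v where uv: "u \<in> \<Union>\<Delta>" "v \<in> \<Union>\<Delta>" "(u, v) \<notin> (edge_rel \<Delta>)\<^sup>*"
    unfolding complex_connected_def by blast
  then have ne: "u \<noteq> v" by auto
  have fin: "finite (\<Union>\<Delta>)" using simplicial_complex_finite_vertices[OF \<Delta>] .
  have sing: "{w} \<in> \<Delta>" if "w \<in> \<Union>\<Delta>" for w
    using that simplicial_complex_subset[OF \<Delta>, of _ "{w}"] by blast
  define c :: "nat set \<Rightarrow> 'k" where "c F = (if F = {u} then 1 else if F = {v} then -1 else 0)" for F
  have "\<forall>F. c F \<noteq> 0 \<longrightarrow> F \<in> \<Delta> \<and> int (card F) = 0 + 1"
    using sing uv by (auto simp: c_def)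
  moreover have "bd \<Delta> c G = 0" if "G \<in> \<Delta>" "int (card G) = 0" for G
  proof -
    have "G = {}" using that simplicial_complex_finite_face[OF \<Delta>] by auto
    moreover have "(\<Sum>w\<in>\<Union>\<Delta>. c {w}) = (\<Sum>w\<in>\<Union>\<Delta>. (if w = u then 1 else 0) + (if w = v then -1 else 0))"
      by (rule sum.cong) (auto simp: c_def ne)
    ultimately show ?thesis
      using uv fin by (simp add: bd_empty[OF \<Delta>] sum.distrib)
  qed
  ultimately obtain d :: "nat set \<Rightarrow> 'k" where
    d: "\<And>G. G \<in> \<Delta> \<Longrightarrow> int (card G) = 0 + 1 \<Longrightarrow> bd \<Delta> d G = c G"
    using van unfolding rhom_zero_def by (smt (verit))
  define C where "C = {w \<in> \<Union>\<Delta>. (u, w) \<in> (edge_rel \<Delta>)\<^sup>*}"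
  define g where "g w x = (if w < x then - d {x, w} else d {x, w})" for w x
  define P where "P = (SIGMA w:C. {x \<in> C. x \<noteq> w \<and> {x, w} \<in> \<Delta>})"
  have finC: "finite C" using fin unfolding C_def by (rule finite_subset[rotated]) blast
  have "(\<Sum>w\<in>C. c {w}) = (\<Sum>w\<in>C. if w = u then 1 else 0)"
    using uv by (intro sum.cong) (auto simp: c_def C_def)
  also have "\<dots> = 1" using uv finC by (simp add: C_def)
  finally have one: "(\<Sum>w\<in>C. c {w}) = 1" .
  \<comment> \<open>A component contains all neighbours of its vertices, so restricting the boundary
    sum to \<open>C\<close> loses no edge.\<close>
  have nb: "{x \<in> \<Union>\<Delta>. x \<noteq> w \<and> {x, w} \<in> \<Delta>} = {x \<in> C. x \<noteq> w \<and> {x, w} \<in> \<Delta>}" if "w \<in> C" for w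
    using that by (auto simp: C_def insert_commute intro: rtrancl_into_rtrancl)
  have "(\<Sum>w\<in>C. c {w}) = (\<Sum>w\<in>C. bd \<Delta> d {w})"
    using sing by (intro sum.cong) (auto simp: d C_def)
  also have "\<dots> = (\<Sum>w\<in>C. \<Sum>x\<in>{x \<in> C. x \<noteq> w \<and> {x, w} \<in> \<Delta>}. g w x)"
    unfolding bd_singleton g_def using nb by (intro sum.cong) auto
  also have "\<dots> = (\<Sum>(w, x)\<in>P. g w x)"
    unfolding P_def using finC by (subst sum.Sigma) auto
  also have "\<dots> = 0"
  proof (rule sum_antisymmetric)
    show "finite P" unfolding P_def using finC by auto
    show "sym P" by (auto simp: P_def sym_def insert_commute)
    show "irrefl P" by (auto simp: P_def irrefl_def)
    show "g y x = - g x y" if "(x, y) \<in> P" for x y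
      using that by (auto simp: g_def P_def insert_commute)
  qed
  finally show False using one by simp
qed

text \<open>Fix a base vertex u. A path from u to v, read as a 1-chain, has boundary v - u. A
  0-cycle c has coefficient sum 0, so c is the sum of the c(v) (v - u), hence a boundary.\<close>

lemma connected_imp_rhom_zero_0:
  fixes K :: "'k::field itself"
  assumes \<Delta>: "simplicial_complex \<Delta>" and con: "complex_connected \<Delta>"
  shows "rhom_zero K \<Delta> 0"
proof -
  have fin: "finite (\<Union>\<Delta>)" using simplicial_complex_finite_vertices[OF \<Delta>] .
  have sing: "{w} \<in> \<Delta>" if "w \<in> \<Union>\<Delta>" for w
    using that simplicial_complex_subset[OF \<Delta>, of _ "{w}"] by blast
  define \<delta> :: "nat \<Rightarrow> nat \<Rightarrow> 'k" where "\<delta> v w = (if w = v then 1 else 0)" for v w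
  define supp :: "(nat set \<Rightarrow> 'k) \<Rightarrow> bool"
    where "supp d \<longleftrightarrow> (\<forall>F. d F \<noteq> 0 \<longrightarrow> F \<in> \<Delta> \<and> card F = 2)" for d
  have edge: "\<exists>d. supp d \<and> (\<forall>w. bd \<Delta> d {w} = \<delta> b w - \<delta> a w)" if ab: "{a, b} \<in> \<Delta>" for a b
  proof (cases "a = b")
    \<comment> \<open>\<open>edge_rel\<close> contains the loop at every vertex, because {a, a} =
      {a}.\<close>
    case True
    then show ?thesis by (intro exI[of _ "\<lambda>_. 0"]) (simp add: supp_def bd_def)
  next
    case False
    \<comment> \<open>The sign orients the edge from a to b, whichever of the two numbers is
      smaller.\<close>
    define d :: "nat set \<Rightarrow> 'k" where
      "d F = (if F = {a, b} then (if a < b then 1 else -1) else 0)" for F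
    have "supp d" using ab False by (auto simp: supp_def d_def)
    moreover have "bd \<Delta> d {w} = \<delta> b w - \<delta> a w" for w
    proof -
      let ?N = "{x \<in> \<Union>\<Delta>. x \<noteq> w \<and> {x, w} \<in> \<Delta>}"
      have finN: "finite ?N" using fin by (rule finite_subset[rotated]) blast
      have "bd \<Delta> d {w} = (\<Sum>x\<in>?N. (if x = a \<and> w = b then 1 else 0) + (if x = b \<and> w = a then -1 else 0))"
        unfolding bd_singleton
        by (rule sum.cong) (use False in \<open>auto simp: d_def doubleton_eq_iff\<close>)
      also have "\<dots> = (\<Sum>x\<in>?N. if x = a then \<delta> b w else 0) - (\<Sum>x\<in>?N. if x = b then \<delta> a w else 0)"
        unfolding sum_subtractf[symmetric] by (rule sum.cong) (auto simp: \<delta>_def)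
      also have "\<dots> = \<delta> b w - \<delta> a w"
        using finN ab False by (auto simp: \<delta>_def insert_commute)
      finally show ?thesis .
    qed
    ultimately show ?thesis by blast
  qed
  have path: "\<exists>d. supp d \<and> (\<forall>w. bd \<Delta> d {w} = \<delta> b w - \<delta> a w)" if "(a, b) \<in> (edge_rel \<Delta>)\<^sup>*" for a b
    using that
  proof (induction rule: rtrancl_induct)
    case base
    then show ?case by (intro exI[of _ "\<lambda>_. 0"]) (simp add: supp_def bd_def)
  next
    case (step y z)
    obtain d where d: "supp d" "\<And>w. bd \<Delta> d {w} = \<delta> y w - \<delta> a w" using step.IH by blast
    obtain e where e: "supp e" "\<And>w. bd \<Delta> e {w} = \<delta> z w - \<delta> y w" using edge step.hyps(2) by blast
    have "bd \<Delta> (\<lambda>F. d F + e F) {w} = \<delta> z w - \<delta> a w" for w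
    proof -
      have "bd \<Delta> (\<lambda>F. d F + e F) {w} = bd \<Delta> d {w} + bd \<Delta> e {w}"
        by (simp add: bd_def sum.distrib distrib_left)
      then show ?thesis by (simp add: d e)
    qed
    moreover have "supp (\<lambda>F. d F + e F)" using d(1) e(1) unfolding supp_def by force
    ultimately show ?case by blast
  qed
  show ?thesis
  proof (cases "\<Union>\<Delta> = {}")
    case True
    then have "F \<in> \<Delta> \<Longrightarrow> card F = 0" for F by auto
    then show ?thesis unfolding rhom_zero_def by force
  next
    case False
    then obtain u where u: "u \<in> \<Union>\<Delta>" by blast
    have "\<forall>v\<in>\<Union>\<Delta>. \<exists>d. supp d \<and> (\<forall>w. bd \<Delta> d {w} = \<delta> v w - \<delta> u w)"
      using path con u unfolding complex_connected_def by blast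
    then obtain D where D: "\<And>v. v \<in> \<Union>\<Delta> \<Longrightarrow> supp (D v)"
      "\<And>v w. v \<in> \<Union>\<Delta> \<Longrightarrow> bd \<Delta> (D v) {w} = \<delta> v w - \<delta> u w" by metis
    have "\<exists>d :: nat set \<Rightarrow> 'k. (\<forall>F. d F \<noteq> 0 \<longrightarrow> F \<in> \<Delta> \<and> int (card F) = 0 + 2) \<and>
           (\<forall>G\<in>\<Delta>. int (card G) = 0 + 1 \<longrightarrow> bd \<Delta> d G = c G)"
      if c: "\<forall>G\<in>\<Delta>. int (card G) = 0 \<longrightarrow> bd \<Delta> c G = 0" for c :: "nat set \<Rightarrow> 'k"
    proof -
      define d where "d F = (\<Sum>v\<in>\<Union>\<Delta>. c {v} * D v F)" for F
      have "{} \<in> \<Delta>" using simplicial_complex_subset[OF \<Delta> sing[OF u]] by blast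
      then have c0: "(\<Sum>v\<in>\<Union>\<Delta>. c {v}) = 0" using c bd_empty[OF \<Delta>, of c] by auto
      have "F \<in> \<Delta> \<and> int (card F) = 0 + 2" if dF: "d F \<noteq> 0" for F
      proof -
        obtain v where "v \<in> \<Union>\<Delta>" "c {v} * D v F \<noteq> 0"
          using dF sum.not_neutral_contains_not_neutral[of "\<lambda>v. c {v} * D v F" "\<Union>\<Delta>"]
            unfolding d_def by blast
        then show ?thesis using D(1)[of v] unfolding supp_def by auto
      qed
      moreover have "bd \<Delta> d G = c G" if G: "G \<in> \<Delta>" "int (card G) = 0 + 1" for G
      proof -
        obtain w where w: "G = {w}" using G(2) by (auto simp: card_1_singleton_iff)
        then have wV: "w \<in> \<Union>\<Delta>" using G(1) by blast
        have "bd \<Delta> d {w} = (\<Sum>v\<in>\<Union>\<Delta>. c {v} * bd \<Delta> (D v) {w})"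
          unfolding bd_def d_def sum_distrib_left
          by (subst sum.swap) (simp add: mult.left_commute)
        also have "\<dots> = (\<Sum>v\<in>\<Union>\<Delta>. c {v} * \<delta> v w) - (\<Sum>v\<in>\<Union>\<Delta>. c {v}) * \<delta> u w"
          unfolding sum_distrib_right sum_subtractf[symmetric]
          by (rule sum.cong) (auto simp: D(2) right_diff_distrib)
        also have "\<dots> = (\<Sum>v\<in>\<Union>\<Delta>. if v = w then c {v} else 0)"
          unfolding c0 by (simp add: \<delta>_def if_distrib[of "(*) _"] eq_commute cong: if_cong)
        also have "\<dots> = c {w}" using fin wV by simp
        finally show ?thesis using w by simp
      qed
      ultimately show ?thesis by blast
    qed
    then show ?thesis unfolding rhom_zero_def by auto
  qed
qed

text \<open>A (-1)-chain is a multiple of the empty face, and the same multiple of the vertex v has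
  it as boundary.\<close>

lemma rhom_zero_minus_1:
  fixes K :: "'k::field itself"
  assumes \<Delta>: "simplicial_complex \<Delta>" and v: "{v} \<in> \<Delta>"
  shows "rhom_zero K \<Delta> (-1)"
proof -
  have "\<exists>d :: nat set \<Rightarrow> 'k. (\<forall>F. d F \<noteq> 0 \<longrightarrow> F \<in> \<Delta> \<and> int (card F) = -1 + 2) \<and>
       (\<forall>G\<in>\<Delta>. int (card G) = -1 + 1 \<longrightarrow> bd \<Delta> d G = c G)" for c :: "nat set \<Rightarrow> 'k"
  proof (intro exI conjI)
    define d where "d F = (if F = {v} then c {} else 0)" for F
    show "\<forall>F. d F \<noteq> 0 \<longrightarrow> F \<in> \<Delta> \<and> int (card F) = -1 + 2" using v by (simp add: d_def)
    have "bd \<Delta> d {} = c {}"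
      using v simplicial_complex_finite_vertices[OF \<Delta>] by (auto simp: bd_empty[OF \<Delta>] d_def)
    then show "\<forall>G\<in>\<Delta>. int (card G) = -1 + 1 \<longrightarrow> bd \<Delta> d G = c G"
      using simplicial_complex_finite_face[OF \<Delta>] by auto
  qed
  then show ?thesis unfolding rhom_zero_def by blast
qed

section \<open>Complexes of dimension at most one\<close>

text \<open>A face of the link of F with two vertices forces F to be empty, so degree 0 matters only
  for the whole complex. Connectedness is required only in the presence of an edge: a discrete set
  of points is Cohen-Macaulay although disconnected.\<close>

lemma cohen_macaulay_dim_1:
  assumes \<Delta>: "simplicial_complex \<Delta>" and dim: "\<And>F. F \<in> \<Delta> \<Longrightarrow> card F \<le> 2"
    and con: "\<And>F. F \<in> \<Delta> \<Longrightarrow> card F = 2 \<Longrightarrow> complex_connected \<Delta>"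
  shows "cohen_macaulay K \<Delta>"
  unfolding cohen_macaulay_def
proof (intro ballI allI impI)
  fix F and i :: int
  assume F: "F \<in> \<Delta>" and i: "i < cdim (lk \<Delta> F)"
  have L: "simplicial_complex (lk \<Delta> F)" using simplicial_complex_lk[OF \<Delta>] .
  have "{} \<in> \<Delta>" using simplicial_complex_subset[OF \<Delta> F] by blast
  then have "{} \<in> lk \<Delta> F" using F by (simp add: lk_def)
  then have "lk \<Delta> F \<noteq> {}" by blast
  then obtain H where H: "H \<in> lk \<Delta> F" "i + 1 < int (card H)"
    using i cdim_less_iff[OF L] by blast
  then have HF: "H \<in> \<Delta>" "H \<union> F \<in> \<Delta>" "H \<inter> F = {}" by (auto simp: lk_def)
  have "finite H" "finite F" using simplicial_complex_finite_face[OF \<Delta>] HF F by auto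
  then have sum: "card H + card F \<le> 2" using dim[OF HF(2)] HF(3) by (simp add: card_Un_disjoint)
  consider "i < -1" | "i = -1" | "i \<ge> 0" by linarith
  then show "rhom_zero K (lk \<Delta> F) i"
  proof cases
    case 1
    then show ?thesis by (simp add: rhom_zero_def)
  next
    case 2
    then have "card H \<ge> 1" using H(2) by linarith
    then obtain v where "{v} \<in> lk \<Delta> F" using card_ge_1_obtain_vertex[OF L H(1)] by blast
    then show ?thesis using rhom_zero_minus_1[OF L] 2 by blast
  next
    case 3
    then have "i = 0" "card H = 2" "card F = 0" using H(2) sum by linarith+
    then have "F = {}" using \<open>finite F\<close> by simp
    then show ?thesis
      using connected_imp_rhom_zero_0[OF \<Delta> con[OF HF(1)]] \<open>i = 0\<close> \<open>card H = 2\<close>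
      by (simp add: lk_empty)
  qed
qed

lemma cohen_macaulay_imp_connected:
  assumes \<Delta>: "simplicial_complex \<Delta>" and "F \<in> \<Delta>" "card F \<ge> 2" "cohen_macaulay K \<Delta>"
  shows "complex_connected \<Delta>"
proof -
  have "{} \<in> \<Delta>" using simplicial_complex_subset[OF \<Delta> \<open>F \<in> \<Delta>\<close>] by blast
  moreover have "0 < cdim \<Delta>"
    using cdim_less_iff[OF \<Delta>, of 0] assms(2,3) by force
  ultimately have "rhom_zero K \<Delta> 0"
    using assms(4) lk_empty unfolding cohen_macaulay_def by metis
  then show ?thesis using rhom_zero_0_imp_connected[OF \<Delta>] by blast
qed

text \<open>The skeleta are indexed by number of vertices: up to index 1 they have no edge, index 2
  gives back the complex by purity, and beyond that they are void.\<close>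

lemma seq_cohen_macaulay_dim_1:
  assumes \<Delta>: "simplicial_complex \<Delta>" and dim: "\<And>F. F \<in> \<Delta> \<Longrightarrow> card F \<le> 2"
    and pure: "\<And>F. F \<in> \<Delta> \<Longrightarrow> \<exists>H\<in>\<Delta>. card H = 2 \<and> F \<subseteq> H"
    and con: "complex_connected \<Delta>"
  shows "seq_cohen_macaulay K \<Delta>"
  unfolding seq_cohen_macaulay_def
proof
  fix i
  have S: "simplicial_complex (pure_skeleton \<Delta> i)"
    using simplicial_complex_pure_skeleton[OF \<Delta>] .
  have le: "card F \<le> i" if "F \<in> pure_skeleton \<Delta> i" for F
    using that simplicial_complex_finite_face[OF \<Delta>]
    by (auto simp: pure_skeleton_def intro: card_mono)
  consider "i \<le> 1" | "i = 2" | "i > 2" by linarith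
  then show "cohen_macaulay K (pure_skeleton \<Delta> i)"
  proof cases
    case 1
    then show ?thesis using le by (intro cohen_macaulay_dim_1[OF S]) force+
  next
    case 2
    have "pure_skeleton \<Delta> i = \<Delta>"
      using pure simplicial_complex_subset[OF \<Delta>] unfolding 2 pure_skeleton_def by blast
    then show ?thesis using cohen_macaulay_dim_1[OF \<Delta> dim con] by simp
  next
    case 3
    then have "pure_skeleton \<Delta> i = {}" using dim unfolding pure_skeleton_def by fastforce
    then show ?thesis by (simp add: cohen_macaulay_def)
  qed
qed

lemma S2_dim_1:
  assumes \<Delta>: "simplicial_complex \<Delta>" and dim: "\<And>F. F \<in> \<Delta> \<Longrightarrow> card F \<le> 2"
    and con: "complex_connected \<Delta>"
  shows "S2 \<Delta>"
  unfolding S2_def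
proof (intro ballI impI)
  fix F assume F: "F \<in> \<Delta>" and d: "1 \<le> cdim (lk \<Delta> F)"
  have "{} \<in> \<Delta>" using simplicial_complex_subset[OF \<Delta> F] by blast
  then have "{} \<in> lk \<Delta> F" using F by (simp add: lk_def)
  then have "lk \<Delta> F \<noteq> {}" by blast
  moreover have "0 < cdim (lk \<Delta> F)" using d by linarith
  ultimately obtain H where H: "H \<in> lk \<Delta> F" "0 + 1 < int (card H)"
    using cdim_less_iff[OF simplicial_complex_lk[OF \<Delta>]] by blast
  then have HF: "H \<in> \<Delta>" "H \<union> F \<in> \<Delta>" "H \<inter> F = {}" by (auto simp: lk_def)
  have fin: "finite H" "finite F" using simplicial_complex_finite_face[OF \<Delta>] HF F by auto
  then have "card H + card F \<le> 2" using dim[OF HF(2)] HF(3) by (simp add: card_Un_disjoint)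
  then have "card F = 0" using H(2) by linarith
  then have "F = {}" using fin by simp
  then show "complex_connected (lk \<Delta> F)" using con by (simp add: lk_empty)
qed

lemma S2_imp_connected:
  assumes \<Delta>: "simplicial_complex \<Delta>" and "F \<in> \<Delta>" "card F \<ge> 2" "S2 \<Delta>"
  shows "complex_connected \<Delta>"
proof -
  have "{} \<in> \<Delta>" using simplicial_complex_subset[OF \<Delta> \<open>F \<in> \<Delta>\<close>] by blast
  moreover have "0 < cdim \<Delta>"
    using cdim_less_iff[OF \<Delta>, of 0] assms(2,3) by force
  then have "1 \<le> cdim (lk \<Delta> {})" by (simp add: lk_empty)
  ultimately have "complex_connected (lk \<Delta> {})" using assms(4) unfolding S2_def by blast
  then show ?thesis by (simp add: lk_empty)
qed

section \<open>Connectedness from vertex decomposability and from shellability\<close>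

lemma pure_Pow: "pure (Pow F)"
  unfolding pure_def facets_def by blast

lemma vertex_decomposable_imp_pure: "vertex_decomposable \<Delta> \<Longrightarrow> pure \<Delta>"
  by (induction rule: vertex_decomposable.induct) (auto simp: pure_Pow)

text \<open>Induction through the deletion of x. The difficulty is that the lower bound on facet
  sizes must pass to the deletion, where a facet may be a facet of \<Delta> stripped of x. A facet
  of \<Delta> avoiding x stays a facet there, and purity of the deletion gives all others its size.
  If no facet avoids x, the complex is a cone with apex x.\<close>

lemma vertex_decomposable_imp_connected:
  assumes "vertex_decomposable \<Delta>" "simplicial_complex \<Delta>" "\<And>F. F \<in> facets \<Delta> \<Longrightarrow> card F \<ge> 2"
  shows "complex_connected \<Delta>"
  using assms
proof (induction rule: vertex_decomposable.induct)
  case (simplex F)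
  then show ?case by (auto simp: complex_connected_def)
next
  case (step \<Delta> x)
  note \<Delta> = step.prems(1)
  show ?case
  proof (cases "\<exists>G\<in>facets \<Delta>. x \<notin> G")
    case True
    then obtain G where G: "G \<in> facets \<Delta>" "x \<notin> G" by blast
    have "G \<in> facets (del \<Delta> {x})" using G by (auto simp: facets_def del_def)
    then have "card F \<ge> 2" if "F \<in> facets (del \<Delta> {x})" for F
      using vertex_decomposable_imp_pure[OF step.hyps(4)] that step.prems(2)[OF G(1)]
      unfolding pure_def by metis
    then have con: "complex_connected (del \<Delta> {x})"
      using step.IH(2) simplicial_complex_del[OF \<Delta>] by blast
    obtain X where X: "X \<in> \<Delta>" "x \<in> X" using step.hyps(2) by blast
    obtain H where H: "H \<in> facets \<Delta>" "X \<subseteq> H" by (rule face_in_facet[OF \<Delta> X(1)])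
    then have H\<Delta>: "H \<in> \<Delta>" by (simp add: facets_def)
    have "\<not> H \<subseteq> {x}"
      using step.prems(2)[OF H(1)] card_mono[of "{x}" H] by auto
    then obtain y where y: "y \<in> H" "y \<noteq> x" by blast
    have sub: "{x, y} \<in> \<Delta>" "{y} \<in> \<Delta>"
      using simplicial_complex_subset[OF \<Delta> H\<Delta>] y X H by auto
    have yd: "y \<in> \<Union>(del \<Delta> {x})" using sub(2) y(2) by (auto simp: del_def)
    have "(y, v) \<in> (edge_rel \<Delta>)\<^sup>*" if v: "v \<in> \<Union>\<Delta>" for v
    proof (cases "v = x")
      case True
      then show ?thesis using sub(1) by (auto simp: insert_commute)
    next
      case False
      have "{v} \<in> \<Delta>" using v simplicial_complex_subset[OF \<Delta>, of _ "{v}"] by blast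
      then have "v \<in> \<Union>(del \<Delta> {x})" using False by (auto simp: del_def)
      then have "(y, v) \<in> (edge_rel (del \<Delta> {x}))\<^sup>*"
        using con yd unfolding complex_connected_def by blast
      moreover have "edge_rel (del \<Delta> {x}) \<subseteq> edge_rel \<Delta>" by (auto simp: del_def)
      ultimately show ?thesis using rtrancl_mono by blast
    qed
    then show ?thesis by (rule complex_connectedI)
  next
    case False
    have "(x, v) \<in> (edge_rel \<Delta>)\<^sup>*" if v: "v \<in> \<Union>\<Delta>" for v
    proof -
      obtain X where X: "X \<in> \<Delta>" "v \<in> X" using v by blast
      obtain H where H: "H \<in> facets \<Delta>" "X \<subseteq> H" by (rule face_in_facet[OF \<Delta> X(1)])
      then have "H \<in> \<Delta>" "{x, v} \<subseteq> H" using False X by (auto simp: facets_def)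
      then have "{x, v} \<in> \<Delta>" using simplicial_complex_subset[OF \<Delta>] by blast
      then show ?thesis by auto
    qed
    then show ?thesis by (rule complex_connectedI)
  qed
qed

text \<open>Every facet after the first differs from some earlier one in a single vertex; having at
  least two vertices, it shares one with that earlier facet. Strong induction along the order then
  reaches every facet.\<close>

lemma shellable_imp_connected:
  assumes "shellable \<Delta>" and \<Delta>: "simplicial_complex \<Delta>"
    and card: "\<And>F. F \<in> facets \<Delta> \<Longrightarrow> card F \<ge> 2"
  shows "complex_connected \<Delta>"
proof -
  obtain fs where fs: "set fs = facets \<Delta>"
    "\<And>i j. i < length fs \<Longrightarrow> j < i \<Longrightarrow> \<exists>x \<in> fs ! i - fs ! j. \<exists>k<i. fs ! i - fs ! k = {x}"
    using assms(1) unfolding shellable_def by blast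
  show ?thesis
  proof (cases "fs = []")
    case True
    then have "\<Delta> = {}" using fs(1) face_in_facet[OF \<Delta>] by (metis empty_iff empty_set equals0I)
    then show ?thesis by (simp add: complex_connected_def)
  next
    case False
    have facet: "fs ! i \<in> facets \<Delta>" "fs ! i \<in> \<Delta>" "card (fs ! i) \<ge> 2" if "i < length fs" for i
      using that fs(1) nth_mem[OF that] card by (auto simp: facets_def)
    have "fs ! 0 \<noteq> {}" using facet(3)[of 0] False by auto
    then obtain u where u: "u \<in> fs ! 0" by blast
    have reach: "\<forall>v\<in>fs ! i. (u, v) \<in> (edge_rel \<Delta>)\<^sup>*" if "i < length fs" for i
      using that
    proof (induction i rule: less_induct)
      case (less i)
      have "\<exists>w\<in>fs ! i. (u, w) \<in> (edge_rel \<Delta>)\<^sup>*"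
      proof (cases "i = 0")
        case True
        then show ?thesis using u by blast
      next
        case False
        \<comment> \<open>Any earlier facet would do as the comparison; index 0 is always
          available.\<close>
        then obtain x k where k: "k < i" "fs ! i - fs ! k = {x}" using fs(2)[of i 0] less.prems by blast
        have "\<not> fs ! i \<subseteq> {x}"
          using facet(3)[OF less.prems] card_mono[of "{x}" "fs ! i"] by auto
        then obtain w where "w \<in> fs ! i" "w \<in> fs ! k" using k(2) by blast
        then show ?thesis using less.IH[of k] k(1) less.prems by auto
      qed
      then obtain w where w: "w \<in> fs ! i" "(u, w) \<in> (edge_rel \<Delta>)\<^sup>*" by blast
      show ?case
      proof
        fix v assume "v \<in> fs ! i"
        then have "{w, v} \<in> \<Delta>"
          using simplicial_complex_subset[OF \<Delta> facet(2)[OF less.prems]] w(1) by simp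
        then show "(u, v) \<in> (edge_rel \<Delta>)\<^sup>*" using w(2) by (auto intro: rtrancl_into_rtrancl)
      qed
    qed
    have "(u, v) \<in> (edge_rel \<Delta>)\<^sup>*" if v: "v \<in> \<Union>\<Delta>" for v
    proof -
      obtain X where X: "X \<in> \<Delta>" "v \<in> X" using v by blast
      obtain H where H: "H \<in> facets \<Delta>" "X \<subseteq> H" by (rule face_in_facet[OF \<Delta> X(1)])
      then obtain i where "i < length fs" "fs ! i = H" using fs(1) by (metis in_set_conv_nth)
      then show ?thesis using reach X(2) H(2) by blast
    qed
    then show ?thesis by (rule complex_connectedI)
  qed
qed

section \<open>Paths and cycles as complexes\<close>

text \<open>One encoding for paths (p injective up to m) and cycles (p m = p 0), so that facets,
  purity and connectedness are treated once.\<close>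

definition walk_complex :: "(nat \<Rightarrow> nat) \<Rightarrow> nat \<Rightarrow> nat set set" where
  "walk_complex p m = (\<Union>i<m. Pow {p i, p (Suc i)})"

lemma simplicial_complex_walk: "simplicial_complex (walk_complex p m)"
proof -
  have "\<Union>(walk_complex p m) \<subseteq> p ` {..m}" by (auto simp: walk_complex_def)
  then have "finite (\<Union>(walk_complex p m))" by (rule finite_subset) simp
  then show ?thesis by (auto simp: simplicial_complex_def walk_complex_def)
qed

lemma walk_complex_card_le: "F \<in> walk_complex p m \<Longrightarrow> card F \<le> 2"
proof -
  assume "F \<in> walk_complex p m"
  then obtain i where "F \<subseteq> {p i, p (Suc i)}" by (auto simp: walk_complex_def)
  then have "card F \<le> card {p i, p (Suc i)}" by (intro card_mono) auto
  also have "\<dots> \<le> 2" by (simp add: card_insert_if)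
  finally show ?thesis .
qed

lemma walk_complex_connected: "complex_connected (walk_complex p m)"
proof (rule complex_connectedI)
  have reach: "i \<le> m \<Longrightarrow> (p 0, p i) \<in> (edge_rel (walk_complex p m))\<^sup>*" for i
  proof (induction i)
    case (Suc i)
    then have "{p i, p (Suc i)} \<in> walk_complex p m" by (auto simp: walk_complex_def)
    then show ?case using Suc by (auto intro: rtrancl_into_rtrancl)
  qed simp
  fix v assume "v \<in> \<Union>(walk_complex p m)"
  then obtain i where "i < m" "v = p i \<or> v = p (Suc i)" by (auto simp: walk_complex_def)
  then show "(p 0, v) \<in> (edge_rel (walk_complex p m))\<^sup>*" using reach[of i] reach[of "Suc i"] by auto
qed

lemma walk_complex_face_in_edge:
  assumes "\<And>i. i < m \<Longrightarrow> p i \<noteq> p (Suc i)" "F \<in> walk_complex p m"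
  shows "\<exists>H\<in>walk_complex p m. card H = 2 \<and> F \<subseteq> H"
proof -
  obtain i where "i < m" "F \<subseteq> {p i, p (Suc i)}" using assms(2) by (auto simp: walk_complex_def)
  then show ?thesis using assms(1)[of i]
    by (intro bexI[of _ "{p i, p (Suc i)}"]) (auto simp: walk_complex_def)
qed

lemma facets_walk_complex:
  assumes "\<And>i. i < m \<Longrightarrow> p i \<noteq> p (Suc i)"
  shows "facets (walk_complex p m) = (\<lambda>i. {p i, p (Suc i)}) ` {..<m}"
proof (intro equalityI subsetI)
  fix F assume F: "F \<in> facets (walk_complex p m)"
  then obtain i where i: "i < m" "F \<subseteq> {p i, p (Suc i)}"
    by (auto simp: facets_def walk_complex_def)
  then have "{p i, p (Suc i)} \<in> walk_complex p m" by (auto simp: walk_complex_def)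
  then show "F \<in> (\<lambda>i. {p i, p (Suc i)}) ` {..<m}" using F i by (auto simp: facets_def)
next
  fix F assume "F \<in> (\<lambda>i. {p i, p (Suc i)}) ` {..<m}"
  then obtain i where i: "i < m" "F = {p i, p (Suc i)}" by blast
  have "H = F" if H: "H \<in> walk_complex p m" "F \<subseteq> H" for H
  proof -
    have "finite H" using simplicial_complex_finite_face[OF simplicial_complex_walk H(1)] .
    moreover have "card H \<le> card F" using walk_complex_card_le[OF H(1)] assms[OF i(1)] i(2) by simp
    ultimately show ?thesis using card_seteq[OF _ H(2)] by simp
  qed
  then show "F \<in> facets (walk_complex p m)" using i by (auto simp: facets_def walk_complex_def)
qed

lemma pure_walk_complex:
  assumes "\<And>i. i < m \<Longrightarrow> p i \<noteq> p (Suc i)"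
  shows "pure (walk_complex p m)"
proof -
  have "card F = 2" if "F \<in> facets (walk_complex p m)" for F
    using that assms facets_walk_complex[of m p] by auto
  then show ?thesis by (simp add: pure_def)
qed

text \<open>The last vertex is removed: its link is a single point, its deletion the shorter path.
  The index \<open>Suc m\<close> makes the base case one edge, hence a simplex.\<close>

lemma vertex_decomposable_path:
  assumes "inj_on p {..Suc m}"
  shows "vertex_decomposable (walk_complex p (Suc m))"
  using assms
proof (induction m)
  case 0
  have "walk_complex p (Suc 0) = Pow {p 0, p (Suc 0)}" by (auto simp: walk_complex_def)
  then show ?case using vertex_decomposable.simplex[of "{p 0, p (Suc 0)}"] by simp
next
  case (Suc m)
  let ?W = "walk_complex p (Suc (Suc m))" and ?x = "p (Suc (Suc m))"
  have ne: "p i \<noteq> p k" if "i \<le> Suc (Suc m)" "k \<le> Suc (Suc m)" "i \<noteq> k" for i k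
    using inj_onD[OF Suc.prems, of i k] that by auto
  have W: "?W = walk_complex p (Suc m) \<union> Pow {p (Suc m), ?x}"
    by (auto simp: walk_complex_def lessThan_Suc)
  have away: "?x \<notin> F" if "F \<in> walk_complex p (Suc m)" for F
  proof
    assume x: "?x \<in> F"
    obtain i where i: "i < Suc m" "F \<subseteq> {p i, p (Suc i)}" using \<open>F \<in> _\<close> by (auto simp: walk_complex_def)
    then show False using x ne[of i "Suc (Suc m)"] ne[of "Suc i" "Suc (Suc m)"] by auto
  qed
  have mem: "F \<in> walk_complex p (Suc m)" if "F \<subseteq> {p (Suc m)}" for F
    using that by (auto simp: walk_complex_def)
  show ?case
  proof (rule vertex_decomposable.step[of _ ?x])
    show "pure ?W" by (rule pure_walk_complex) (use ne in auto)
    show "?x \<in> \<Union>?W" by (auto simp: W)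
    have "lk ?W {?x} = Pow {p (Suc m)}"
    proof (intro equalityI subsetI)
      fix H assume "H \<in> lk ?W {?x}"
      then have "?x \<notin> H" "insert ?x H \<in> ?W" by (auto simp: lk_def)
      then have "insert ?x H \<in> Pow {p (Suc m), ?x}" using away[of "insert ?x H"] unfolding W by blast
      then show "H \<in> Pow {p (Suc m)}" using \<open>?x \<notin> H\<close> by blast
    next
      fix H assume "H \<in> Pow {p (Suc m)}"
      then show "H \<in> lk ?W {?x}" using ne[of "Suc m" "Suc (Suc m)"] by (auto simp: lk_def W)
    qed
    then show "vertex_decomposable (lk ?W {?x})"
      using vertex_decomposable.simplex[of "{p (Suc m)}"] by simp
    have "del ?W {?x} = walk_complex p (Suc m)"
    proof (intro equalityI subsetI)
      fix H assume "H \<in> del ?W {?x}"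
      then have "?x \<notin> H" "H \<in> ?W" by (auto simp: del_def)
      then show "H \<in> walk_complex p (Suc m)" unfolding W using mem[of H] by blast
    next
      fix H assume "H \<in> walk_complex p (Suc m)"
      then show "H \<in> del ?W {?x}" using away by (auto simp: del_def W)
    qed
    moreover have "inj_on p {..Suc m}" using Suc.prems by (rule inj_on_subset) auto
    ultimately show "vertex_decomposable (del ?W {?x})" using Suc.IH by simp
  qed
qed

lemma vertex_decomposable_two_points:
  assumes "a \<noteq> b"
  shows "vertex_decomposable {{}, {a}, {b}}"
proof (rule vertex_decomposable.step[of _ a])
  show "pure {{}, {a}, {b}}" unfolding pure_def facets_def by auto
  have "lk {{}, {a}, {b}} {a} = Pow {}" using assms by (auto simp: lk_def)
  then show "vertex_decomposable (lk {{}, {a}, {b}} {a})"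
    using vertex_decomposable.simplex[of "{}"] by simp
  have "del {{}, {a}, {b}} {a} = Pow {b}" using assms by (auto simp: del_def)
  then show "vertex_decomposable (del {{}, {a}, {b}} {a})"
    using vertex_decomposable.simplex[of "{b}"] by simp
qed simp

lemma closed_walk_neq:
  assumes "inj_on p {..<n}" "p n = p 0" "2 \<le> n" "i < n"
  shows "p i \<noteq> p (Suc i)"
proof (cases "Suc i = n")
  case True
  then show ?thesis using assms inj_onD[OF assms(1), of i 0] by auto
next
  case False
  then show ?thesis using assms inj_onD[OF assms(1), of i "Suc i"] by auto
qed

text \<open>Removing p 0 leaves the path from p 1 to p (n - 1), and the link of p 0 consists of
  these two end points.\<close>

lemma vertex_decomposable_cycle:
  assumes inj: "inj_on p {..<n}" and cl: "p n = p 0" and n: "3 \<le> n"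
  shows "vertex_decomposable (walk_complex p n)"
proof -
  define q where "q = p \<circ> Suc"
  obtain m where m: "n = Suc (Suc (Suc m))" 
    using le_Suc_ex[OF n] by (auto simp: eval_nat_numeral)
  have ne: "p i \<noteq> p k" if "i < n" "k < n" "i \<noteq> k" for i k
    using inj_onD[OF inj, of i k] that by auto
  let ?W = "walk_complex p n" and ?a = "p 1" and ?b = "p (Suc (Suc m))"
  \<comment> \<open>Separates the indices 0 and n - 1 of the two edges at p 0 from those of the
    remaining path.\<close>
  have "{..<n} = insert 0 (insert (Suc (Suc m)) (Suc ` {..<Suc m}))"
    unfolding m by (subst lessThan_Suc, subst lessThan_Suc_eq_insert_0) blast
  then have W: "?W = Pow {p 0, ?a} \<union> Pow {?b, p 0} \<union> walk_complex q (Suc m)"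
    unfolding walk_complex_def q_def using cl m by auto
  have qinj: "inj_on q {..Suc m}" unfolding q_def m
    by (rule comp_inj_on) (auto intro: inj_on_subset[OF inj] simp: m)
  have away: "p 0 \<notin> F" if "F \<in> walk_complex q (Suc m)" for F
  proof
    assume x: "p 0 \<in> F"
    obtain i where i: "i < Suc m" "F \<subseteq> {q i, q (Suc i)}" using \<open>F \<in> _\<close> by (auto simp: walk_complex_def)
    then show False using x ne[of 0 "Suc i"] ne[of 0 "Suc (Suc i)"] m by (auto simp: q_def)
  qed
  have mem: "F \<in> walk_complex q (Suc m)" if "F \<subseteq> {?a} \<or> F \<subseteq> {?b}" for F
    using that by (auto simp: walk_complex_def q_def)
  have nab: "p 0 \<noteq> ?a" "p 0 \<noteq> ?b" "?a \<noteq> ?b" using ne m by auto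
  show ?thesis
  proof (rule vertex_decomposable.step[of _ "p 0"])
    show "pure ?W" by (rule pure_walk_complex) (use closed_walk_neq[OF inj cl] n in auto)
    show "p 0 \<in> \<Union>?W" by (auto simp: W)
    have "lk ?W {p 0} = {{}, {?a}, {?b}}"
    proof (intro equalityI subsetI)
      fix H assume "H \<in> lk ?W {p 0}"
      then have "p 0 \<notin> H" "insert (p 0) H \<in> ?W" by (auto simp: lk_def)
      then have "insert (p 0) H \<in> Pow {p 0, ?a} \<union> Pow {?b, p 0}" using away[of "insert (p 0) H"] unfolding W by blast
      then have "H \<subseteq> {?a} \<or> H \<subseteq> {?b}" using \<open>p 0 \<notin> H\<close> by blast
      then show "H \<in> {{}, {?a}, {?b}}" by blast
    next
      fix H assume "H \<in> {{}, {?a}, {?b}}"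
      then show "H \<in> lk ?W {p 0}" using nab by (auto simp: lk_def W)
    qed
    then show "vertex_decomposable (lk ?W {p 0})"
      using vertex_decomposable_two_points[OF nab(3)] by simp
    have "del ?W {p 0} = walk_complex q (Suc m)"
    proof (intro equalityI subsetI)
      fix H assume "H \<in> del ?W {p 0}"
      then have "p 0 \<notin> H" "H \<in> ?W" by (auto simp: del_def)
      then show "H \<in> walk_complex q (Suc m)" unfolding W using mem[of H] by blast
    next
      fix H assume "H \<in> walk_complex q (Suc m)"
      then show "H \<in> del ?W {p 0}" using away by (auto simp: del_def W)
    qed
    then show "vertex_decomposable (del ?W {p 0})" using vertex_decomposable_path[OF qinj] by simp
  qed
qed

text \<open>Edges are taken in cyclic order. Each edge but the last adds the new vertex p (i + 1) to
  its predecessor. The closing edge adds none: compared with the edge just before it, p 0 is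
  removed; compared with any other, p (n - 1) is removed, and edge 0 is the witness.\<close>

lemma shellable_cycle:
  assumes inj: "inj_on p {..<n}" and cl: "p n = p 0" and n: "3 \<le> n"
  shows "shellable (walk_complex p n)"
proof -
  define e where "e i = {p i, p (Suc i)}" for i
  have step_ne: "p i \<noteq> p (Suc i)" if "i < n" for i
    using closed_walk_neq[OF inj cl] n that by auto
  have ne: "p i \<noteq> p k" if "i < n" "k < n" "i \<noteq> k" for i k
    using inj_onD[OF inj, of i k] that by auto
  have shell: "\<exists>x\<in>e i - e j. \<exists>k<i. e i - e k = {x}" if ij: "i < n" "j < i" for i j
  proof (cases "Suc i = n")
    case False
    obtain k where k: "i = Suc k" using ij(2) by (cases i) auto
    have "Suc i < n" using False ij by simp
    then have "p (Suc i) \<in> e i - e j" "e i - e k = {p (Suc i)}"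
      using ij k ne[of "Suc i" j] ne[of "Suc i" "Suc j"] ne[of "Suc i" k] step_ne[of i]
      by (auto simp: e_def)
    then show ?thesis using k by blast
  next
    case last: True
    then have ei: "e i = {p i, p 0}" using cl by (simp add: e_def)
    show ?thesis
    proof (cases "Suc j = i")
      case True
      then have "p 0 \<in> e i - e j" "e i - e j = {p 0}"
        using ij last n ne[of 0 i] ne[of 0 j] unfolding ei by (auto simp: e_def)
      then show ?thesis using ij(2) by blast
    next
      case False
      then have "p i \<in> e i - e j" "e i - e 0 = {p i}"
        using ij last n ne[of i j] ne[of i "Suc j"] ne[of i 0] ne[of i 1]
        unfolding ei by (auto simp: e_def)
      then show ?thesis using ij by (intro bexI[of _ "p i"] exI[of _ 0]) auto
    qed
  qed
  \<comment> \<open>Distinctness comes from the shelling condition itself, which puts a vertex into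
    e i - e j.\<close>
  have "e i \<noteq> e j" if "j < i" "i < n" for i j
    using shell[OF that(2,1)] by blast
  then have "inj_on e {0..<n}"
    by (intro inj_onI) (metis atLeastLessThan_iff linorder_neqE_nat)
  then have dist: "distinct (map e [0..<n])" by (simp add: distinct_map)
  have set: "set (map e [0..<n]) = facets (walk_complex p n)"
    using facets_walk_complex[of n p] step_ne by (auto simp: e_def)
  show ?thesis
    unfolding shellable_def
  proof (intro conjI exI[of _ "map e [0..<n]"] allI impI)
    show "pure (walk_complex p n)" using pure_walk_complex step_ne by blast
    fix i j assume "i < length (map e [0..<n])" "j < i"
    then have ij: "i < n" "j < i" by auto
    then obtain x k where x: "x \<in> e i - e j" "k < i" "e i - e k = {x}" using shell[OF ij] by blast
    have "map e [0..<n] ! i = e i" "map e [0..<n] ! j = e j" "map e [0..<n] ! k = e k"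
      using ij x(2) by auto
    then show "\<exists>x\<in>map e [0..<n] ! i - map e [0..<n] ! j. \<exists>k<i. map e [0..<n] ! i - map e [0..<n] ! k = {x}"
      using x by metis
  qed (use dist set in auto)
qed

section \<open>The complement of a cyclic jump graph\<close>

lemma induced_matching_edgeE:
  assumes "induced_matching V E M" "e \<in> M"
  obtains a b where "e = {a, b}" "a \<in> V" "b \<in> V" "E a b"
proof -
  have "\<forall>e\<in>M. \<exists>a b. e = {a, b} \<and> a \<in> V \<and> b \<in> V \<and> E a b"
    using assms(1) unfolding induced_matching_def by simp
  then show thesis using assms(2) that by blast
qed

locale circulant_minus_jump =
  fixes n j :: nat
  assumes n: "4 \<le> n" and j1: "1 \<le> j" and j2: "j \<le> n div 2"
begin

section \<open>The complement graph as jumps by j modulo n\<close>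

abbreviation "E \<equiv> circ_adj n ({1..n div 2} - {j})"
abbreviation "\<Delta> \<equiv> ind_complex {0..<n} E"

text \<open>Congruence of b to a + j or a - j modulo n, spelled out without mod or truncated
  subtraction so that linear arithmetic applies to vertices below n. \<open>nxt\<close> and
  \<open>prv\<close> are the two jumps; they coincide when n = 2 * j.\<close>

definition nb :: "nat \<Rightarrow> nat \<Rightarrow> bool" where
  "nb a b \<longleftrightarrow> b = a + j \<or> a = b + j \<or> b + n = a + j \<or> a + n = b + j"

definition nxt :: "nat \<Rightarrow> nat" where
  "nxt a = (if a + j < n then a + j else a + j - n)"

definition prv :: "nat \<Rightarrow> nat" where
  "prv a = (if j \<le> a then a - j else a + n - j)"

lemma j_bound: "2 * j \<le> n" using j2 by linarith

text \<open>The circular distance of distinct vertices always lies in {1..n div 2}, so only the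
  value j is missing.\<close>

lemma E_iff: "E a b \<longleftrightarrow> a < n \<and> b < n \<and> a \<noteq> b \<and> \<not> nb a b"
  using n j1 j2 unfolding circ_adj_def nb_def Let_def min_def by auto

lemma nb_sym: "nb a b \<longleftrightarrow> nb b a"
  unfolding nb_def by auto

lemma face_iff: "F \<in> \<Delta> \<longleftrightarrow> F \<subseteq> {0..<n} \<and> (\<forall>a\<in>F. \<forall>b\<in>F. a = b \<or> nb a b)"
  unfolding ind_complex_def E_iff by (auto simp: subset_eq)

lemma nxt_less: "a < n \<Longrightarrow> nxt a < n"
  using n j_bound unfolding nxt_def by auto

lemma nb_nxt: "a < n \<Longrightarrow> nb a (nxt a)"
  unfolding nxt_def nb_def by auto

lemma nxt_neq: "nxt a \<noteq> a"
  using n j1 j_bound unfolding nxt_def by auto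

lemma nb_cases: "a < n \<Longrightarrow> b < n \<Longrightarrow> nb a b \<Longrightarrow> b = nxt a \<or> a = nxt b"
  unfolding nxt_def nb_def by auto

lemma nb_cases': "a < n \<Longrightarrow> b < n \<Longrightarrow> nb a b \<Longrightarrow> b = nxt a \<or> b = prv a"
  unfolding nxt_def prv_def nb_def by auto

lemma nxt_inj: "a < n \<Longrightarrow> b < n \<Longrightarrow> nxt a = nxt b \<Longrightarrow> a = b"
  using j_bound unfolding nxt_def by (auto split: if_splits)

lemma prv_inj: "a < n \<Longrightarrow> b < n \<Longrightarrow> prv a = prv b \<Longrightarrow> a = b"
  using j_bound unfolding prv_def by (auto split: if_splits)

section \<open>Faces, well-coveredness and the Buchsbaum property\<close>

lemma edge_face: "a < n \<Longrightarrow> {a, nxt a} \<in> \<Delta>"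
  unfolding face_iff using nxt_less nb_nxt nb_sym by auto

lemma complex: "simplicial_complex \<Delta>"
  by (rule simplicial_complex_ind_complex) simp

text \<open>The differences around the triangle are each j or -j and sum to 0 modulo n, so n divides
  j or 3 * j. As 0 < 2 * j \<le> n, only n = 3 * j remains.\<close>

lemma triangle:
  assumes "a < n" "b < n" "c < n" "a \<noteq> b" "a \<noteq> c" "b \<noteq> c" "nb a b" "nb a c" "nb b c"
  shows "n = 3 * j"
  using assms n j1 j_bound unfolding nb_def by - (elim disjE; linarith)

lemma face_card_le_2:
  assumes "n \<noteq> 3 * j" "F \<in> \<Delta>"
  shows "card F \<le> 2"
proof (rule ccontr)
  assume "\<not> card F \<le> 2"
  then have "3 \<le> card F" by simp
  then obtain T where T: "T \<subseteq> F" "card T = 3" by (rule obtain_subset_with_card_n)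
  then obtain a b c where abc: "T = {a, b, c}" "a \<noteq> b" "a \<noteq> c" "b \<noteq> c" by (auto simp: card_3_iff)
  then have "a \<in> F" "b \<in> F" "c \<in> F" using T(1) by auto
  moreover from this have "a < n" "b < n" "c < n" using assms(2) unfolding face_iff by auto
  moreover have "\<forall>a\<in>F. \<forall>b\<in>F. a = b \<or> nb a b" using assms(2) unfolding face_iff by simp
  ultimately show False using triangle[of a b c] abc(2-4) assms(1) by blast
qed

lemma facet_card:
  assumes I: "I \<in> facets \<Delta>"
  shows "card I = (if n = 3 * j then 3 else 2)"
proof -
  have I\<Delta>: "I \<in> \<Delta>" and max: "\<And>H. H \<in> \<Delta> \<Longrightarrow> I \<subseteq> H \<Longrightarrow> H = I"
    using I by (auto simp: facets_def)
  have "{0, nxt 0} \<in> \<Delta>" using edge_face n by simp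
  then have "I \<noteq> {}" using max by blast
  then obtain a where a: "a \<in> I" by blast
  then have an: "a < n" using I\<Delta> unfolding face_iff by auto
  show ?thesis
  proof (cases "n = 3 * j")
    case True
    \<comment> \<open>Here jumping by j has order three, and T is the whole orbit of a.\<close>
    define T where "T = {a, nxt a, nxt (nxt a)}"
    have d: "nxt (nxt a) \<noteq> a" "nb a (nxt (nxt a))"
      unfolding nxt_def nb_def using True an j1 by auto
    have "T \<in> \<Delta>"
      using d nxt_less[OF an] nxt_less[OF nxt_less[OF an]] nb_nxt[OF an] nb_nxt[OF nxt_less[OF an]] an
      unfolding face_iff T_def by (auto simp: nb_sym)
    moreover have "I \<subseteq> T"
    proof
      fix b assume "b \<in> I"
      then have "b < n" "b = a \<or> nb a b" using I\<Delta> a unfolding face_iff by auto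
      then show "b \<in> T" using True an j1 unfolding T_def nb_def nxt_def by auto
    qed
    ultimately have "I = T" using max by blast
    then show ?thesis using d nxt_neq[of a] nxt_neq[of "nxt a"] True by (simp add: T_def)
  next
    case False
    have fin: "finite I" using simplicial_complex_finite_face[OF complex I\<Delta>] .
    have "card I \<noteq> 1"
    proof
      assume "card I = 1"
      then have "I = {a}" using a by (auto simp: card_1_singleton_iff)
      then show False using max[OF edge_face[OF an]] nxt_neq[of a] by auto
    qed
    moreover have "card I \<noteq> 0" using fin a by auto
    ultimately show ?thesis using face_card_le_2[OF False I\<Delta>] False by simp
  qed
qed

lemma well_covered_circulant: "well_covered {0..<n} E"
  unfolding well_covered_def using facet_card by simp

text \<open>At most the two vertices x + j and x - j survive the removal of the closed neighbourhood
  of x. Their complex is a simplex or has no edge, also when n = 3 * j.\<close>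

lemma buchsbaum_circulant: "buchsbaum_graph K {0..<n} E"
  unfolding buchsbaum_graph_def
proof
  fix x assume x: "x \<in> {0..<n}"
  define W where "W = {0..<n} - ({x} \<union> {y \<in> {0..<n}. E x y})"
  have "W \<subseteq> {nxt x, prv x}"
  proof
    fix y assume "y \<in> W"
    then have "y < n" "nb x y" using x unfolding W_def E_iff by auto
    then show "y \<in> {nxt x, prv x}" using nb_cases'[of x y] x by simp
  qed
  then have "card W \<le> card {nxt x, prv x}" by (intro card_mono) auto
  also have "\<dots> \<le> 2" by (simp add: card_insert_if)
  finally have W: "card W \<le> 2" "finite W" by (auto simp: W_def)
  have complexW: "simplicial_complex (ind_complex W E)"
    using simplicial_complex_ind_complex[OF W(2)] .
  have sub: "F \<subseteq> W" if "F \<in> ind_complex W E" for F using that by (simp add: ind_complex_def)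
  have le: "card F \<le> 2" if "F \<in> ind_complex W E" for F
    using card_mono[OF W(2) sub[OF that]] W(1) by simp
  show "cohen_macaulay K (ind_complex W E)"
  proof (rule cohen_macaulay_dim_1[OF complexW le])
    fix F assume F: "F \<in> ind_complex W E" "card F = 2"
    then have "F = W" using card_seteq[OF W(2) sub] W(1) by simp
    show "complex_connected (ind_complex W E)"
      unfolding complex_connected_def
    proof (intro ballI)
      fix u v assume "u \<in> \<Union>(ind_complex W E)" "v \<in> \<Union>(ind_complex W E)"
      then have "{u, v} \<subseteq> W" using sub by blast
      then have "{u, v} \<in> ind_complex W E"
        using simplicial_complex_subset[OF complexW F(1)] \<open>F = W\<close> by blast
      then show "(u, v) \<in> (edge_rel (ind_complex W E))\<^sup>*" by (intro r_into_rtrancl) simp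
    qed
  qed
qed

subsection \<open>Induced matchings\<close>

text \<open>Both pairs {a + j, a - j} and {b + j, b - j} equal {c, d}. Since a and b differ, a + j =
  b - j and a - j = b + j modulo n, so n divides 4 * j. The remaining option 4 * j = 2 * n would
  give a = b.\<close>

lemma matching_edge_determined:
  assumes "a < n" "b < n" "c < n" "d < n" "c \<noteq> d" "a \<noteq> b"
    and "nb a c" "nb a d" "nb b c" "nb b d"
  shows "n = 4 * j \<and> {c, d} = {nxt a, prv a}"
proof
  have "nxt a = prv b" "prv a = nxt b"
    using nb_cases'[of a c] nb_cases'[of a d] nb_cases'[of b c] nb_cases'[of b d]
      nxt_inj[of a b] prv_inj[of a b] assms by metis+
  then show "n = 4 * j"
    using assms(1,2,6) n j1 j_bound unfolding nxt_def prv_def by (auto split: if_splits)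
  show "{c, d} = {nxt a, prv a}"
    using nb_cases'[of a c] nb_cases'[of a d] assms by auto
qed

text \<open>An edge of the graph between e and f would belong to M and meet both, so all four cross
  pairs are jumps. The second edge f then depends on a alone, which bounds M by two edges.\<close>

lemma matching_pair:
  assumes M: "induced_matching {0..<n} E M" and e: "e \<in> M" "a \<in> e" and f: "f \<in> M" "f \<noteq> e"
  shows "n = 4 * j \<and> f = {nxt a, prv a}"
proof -
  have disjoint: "\<forall>e\<in>M. \<forall>f\<in>M. e \<noteq> f \<longrightarrow> e \<inter> f = {}"
    and induced: "\<forall>a\<in>\<Union>M. \<forall>b\<in>\<Union>M. E a b \<longrightarrow> {a, b} \<in> M"
    using M unfolding induced_matching_def by simp_all
  have disj: "e \<inter> f = {}" using disjoint e(1) f by blast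
  obtain a' b where ab: "e = {a', b}" "E a' b" by (rule induced_matching_edgeE[OF M e(1)])
  obtain c d where cd: "f = {c, d}" "E c d" by (rule induced_matching_edgeE[OF M f(1)])
  have no: "\<not> E x y" if "x \<in> e" "y \<in> f" for x y
  proof
    assume "E x y"
    then have xy: "{x, y} \<in> M" using induced that e(1) f(1) by blast
    have "{x, y} = e" using disjoint[rule_format, OF xy e(1)] that(1) by auto
    then show False using that(2) disj by blast
  qed
  have nbs: "nb x y" if "x \<in> e" "y \<in> f" for x y
    using no[OF that] that disj ab cd unfolding E_iff by auto
  obtain b' where b': "e = {a, b'}" "a \<noteq> b'" "a < n" "b' < n"
    using ab e(2) unfolding E_iff by auto
  show ?thesis
    using matching_edge_determined[of a b' c d] b' cd nbs unfolding E_iff by simp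
qed

lemma induced_matching_number_eq:
  "induced_matching_number {0..<n} E = (if n = 4 * j then 2 else 1)"
proof -
  let ?S = "{card M | M. induced_matching {0..<n} E M}"
  have sub: "M \<subseteq> Pow {0..<n}" if "induced_matching {0..<n} E M" for M
    by (auto elim!: induced_matching_edgeE[OF that])
  then have "?S \<subseteq> card ` Pow (Pow {0..<n})" by blast
  then have fin: "finite ?S" by (rule finite_subset) simp
  have le: "card M \<le> (if n = 4 * j then 2 else 1)" if M: "induced_matching {0..<n} E M" for M
  proof (cases "M = {}")
    case False
    then obtain e where e: "e \<in> M" by blast
    obtain a b where "e = {a, b}" by (rule induced_matching_edgeE[OF M e])
    then have a: "a \<in> e" by simp
    have "M \<subseteq> (if n = 4 * j then {e, {nxt a, prv a}} else {e})"
      using matching_pair[OF M e a] by auto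
    then have "card M \<le> card (if n = 4 * j then {e, {nxt a, prv a}} else {e})"
      by (intro card_mono) auto
    also have "\<dots> \<le> (if n = 4 * j then 2 else 1)" by (simp add: card_insert_if)
    finally show ?thesis .
  qed simp
  have single: "induced_matching {0..<n} E {{a, b}}" if "E a b" for a b
    using that unfolding induced_matching_def E_iff by (auto simp: insert_commute)
  have "(if n = 4 * j then 2 else 1) \<in> ?S"
  proof (cases "n = 4 * j")
    case True
    \<comment> \<open>The diagonals of the complement's 4-cycle 0, j, 2 * j, 3 * j.\<close>
    define M where "M = {{0, 2 * j}, {j, 3 * j}}"
    have edge: "E 0 (2 * j)" "E j (3 * j)" using True j1 unfolding E_iff nb_def by auto
    have "nb 0 j" "nb 0 (3 * j)" "nb (2 * j) j" "nb (2 * j) (3 * j)"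
      unfolding nb_def using True by auto
    note cross = this this[THEN iffD1[OF nb_sym]]
    have "induced_matching {0..<n} E M"
      unfolding induced_matching_def
    proof (intro conjI ballI)
      fix e assume "e \<in> M"
      then consider "e = {0, 2 * j}" | "e = {j, 3 * j}" by (auto simp: M_def)
      then show "\<exists>a b. e = {a, b} \<and> a \<in> {0..<n} \<and> b \<in> {0..<n} \<and> E a b"
      proof cases
        case 1
        then show ?thesis using edge(1) True j1 by (intro exI[of _ 0] exI[of _ "2 * j"]) simp
      next
        case 2
        then show ?thesis using edge(2) True j1 by (intro exI[of _ j] exI[of _ "3 * j"]) simp
      qed
    next
      show "e \<noteq> f \<longrightarrow> e \<inter> f = {}" if "e \<in> M" "f \<in> M" for e f
        using that True j1 unfolding M_def by auto
      show "E a b \<longrightarrow> {a, b} \<in> M" if "a \<in> \<Union>M" "b \<in> \<Union>M" for a b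
        using that cross unfolding E_iff M_def by (auto simp: insert_commute)
    qed
    moreover have "card M = 2" using j1 by (auto simp: M_def card_insert_if doubleton_eq_iff)
    ultimately show ?thesis using True by force
  next
    case False
    \<comment> \<open>The distance 1 gives an edge unless it is the missing jump; then 2 does, as n
      \<ge> 4.\<close>
    have "E 0 (if j = 1 then 2 else 1)"
      using n j_bound unfolding E_iff nb_def by auto
    from single[OF this] show ?thesis using False by force
  qed
  then show ?thesis
    unfolding induced_matching_number_def using le by (intro Max_eqI[OF fin]) auto
qed

text \<open>With g the gcd, n = 4 * g and j = g * m, the bound on j gives m \<le> 2, and m = 2 would
  make 2 * g a common divisor.\<close>

lemma quotient_eq_4_iff: "n div gcd n j = 4 \<longleftrightarrow> n = 4 * j"
proof
  assume k: "n div gcd n j = 4"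
  obtain g where g: "g = gcd n j" by simp
  then have n4: "n = 4 * g" using k by (metis dvd_mult_div_cancel gcd_dvd1 mult.commute)
  obtain m where m: "j = g * m" using g by (metis dvd_def gcd_dvd2)
  have "g > 0" using n4 n by simp
  have "g * m \<le> g * 2" using j_bound n4 m by simp
  then have "m \<le> 2" using \<open>g > 0\<close> by simp
  moreover have "m \<noteq> 0" using m j1 by auto
  moreover have "m \<noteq> 2"
  proof
    assume "m = 2"
    then have "2 * g dvd gcd n j" using n4 m by auto
    then have "2 * g \<le> g" unfolding g[symmetric] using \<open>g > 0\<close> by (rule dvd_imp_le)
    then show False using \<open>g > 0\<close> by simp
  qed
  ultimately show "n = 4 * j" using m n4 by (cases "m = 1") auto
next
  assume "n = 4 * j"
  then show "n div gcd n j = 4" using j1 by simp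
qed

subsection \<open>Connectedness\<close>

text \<open>Stated for subcomplexes so that it applies to \<Delta> and to its pure 1-skeleton. The
  vertices 0 and 1 suffice: their residues agree only modulo 1.\<close>

lemma connected_imp_coprime:
  assumes "\<Gamma> \<subseteq> \<Delta>" "complex_connected \<Gamma>" "0 \<in> \<Union>\<Gamma>" "1 \<in> \<Union>\<Gamma>"
  shows "gcd n j = 1"
proof -
  let ?g = "gcd n j"
  have shift: "(a + j) mod ?g = a mod ?g" "(a + n) mod ?g = a mod ?g" for a
    by (metis mod_add_right_eq add_0_right mod_eq_0_iff_dvd gcd_dvd2)
      (metis mod_add_right_eq add_0_right mod_eq_0_iff_dvd gcd_dvd1)
  have "a mod ?g = b mod ?g" if "{a, b} \<in> \<Gamma>" for a b
  proof -
    have "a = b \<or> nb a b" using that assms(1) face_iff by auto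
    then show ?thesis unfolding nb_def using shift by metis
  qed
  then have "0 mod ?g = 1 mod ?g"
    using connected_constant[OF assms(2-4), of "\<lambda>a. a mod ?g"] by blast
  then show ?thesis by (metis mod_0 mod_eq_0_iff_dvd nat_dvd_1_iff_1)
qed

lemma vertices: "a < n \<Longrightarrow> a \<in> \<Union>\<Delta>"
  using edge_face by blast

text \<open>Since j is invertible modulo n, the multiples of j run through all vertices exactly
  once, consecutive ones being a jump apart.\<close>

lemma coprime_imp_cycle:
  assumes "gcd n j = 1"
  defines "p \<equiv> \<lambda>i. (i * j) mod n"
  shows "\<Delta> = walk_complex p n" "inj_on p {..<n}" "p n = p 0"
proof -
  show inj: "inj_on p {..<n}"
  proof (rule inj_onI)
    fix a b assume "a \<in> {..<n}" "b \<in> {..<n}" "p a = p b"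
    moreover have "coprime j n" using assms(1) by (simp add: coprime_iff_gcd_eq_1 gcd.commute)
    ultimately show "a = b"
      using cong_mult_rcancel_nat[of j n a b] unfolding p_def by (auto simp: cong_def)
  qed
  show "p n = p 0" by (simp add: p_def)
  have less: "p i < n" for i using n by (simp add: p_def)
  have "p ` {..<n} = {..<n}" by (rule endo_inj_surj) (use inj less in auto)
  then have surj: "\<exists>i<n. a = p i" if "a < n" for a using that by blast
  have nxt: "nxt (p i) = p (Suc i)" for i
  proof -
    have "p (Suc i) = (p i + j) mod n" by (simp add: p_def mod_add_right_eq add.commute)
    then show ?thesis using less[of i] j_bound j1 unfolding nxt_def by (simp add: mod_if)
  qed
  \<comment> \<open>Otherwise j would be the gcd, so j = 1 and n = 3; this is where n \<ge> 4
    excludes a filled triangle.\<close>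
  have n3: "n \<noteq> 3 * j"
  proof
    assume "n = 3 * j"
    then have "gcd n j = j" by simp
    then show False using assms(1) n \<open>n = 3 * j\<close> by simp
  qed
  show "\<Delta> = walk_complex p n"
  proof (intro equalityI subsetI)
    fix F assume F: "F \<in> \<Delta>"
    have "\<exists>a<n. F \<subseteq> {a, nxt a}"
    proof (cases "F = {}")
      case True
      then show ?thesis using n by (intro exI[of _ 0]) auto
    next
      case False
      then obtain a where a: "a \<in> F" by blast
      then have an: "a < n" using F face_iff by auto
      show ?thesis
      proof (cases "F = {a}")
        case True
        then show ?thesis using an by blast
      next
        case False
        then obtain b where b: "b \<in> F" "b \<noteq> a" using a by blast
        then have bn: "b < n" "nb a b" using F a face_iff by auto
        have "finite F" using simplicial_complex_finite_face[OF complex F] .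
        moreover have "{a, b} \<subseteq> F" "card F \<le> card {a, b}"
          using a b face_card_le_2[OF n3 F] by auto
        ultimately have "{a, b} = F" using card_seteq by blast
        then show ?thesis using nb_cases[OF an bn] an bn(1) by auto
      qed
    qed
    then show "F \<in> walk_complex p n" using surj nxt by (fastforce simp: walk_complex_def)
  next
    fix F assume "F \<in> walk_complex p n"
    then obtain i where "F \<subseteq> {p i, nxt (p i)}" by (auto simp: walk_complex_def nxt)
    then show "F \<in> \<Delta>" using simplicial_complex_subset[OF complex edge_face[OF less]] by blast
  qed
qed

section \<open>The five properties and coprimality\<close>

lemma coprime_imp:
  assumes "gcd n j = 1"
  shows "vertex_decomposable \<Delta>" "shellable \<Delta>" "cohen_macaulay K \<Delta>"
    "seq_cohen_macaulay K \<Delta>" "S2 \<Delta>"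
proof -
  define p where "p = (\<lambda>i. (i * j) mod n)"
  have \<Delta>: "\<Delta> = walk_complex p n" and inj: "inj_on p {..<n}" and cl: "p n = p 0"
    using coprime_imp_cycle[OF assms] unfolding p_def by auto
  have ne: "p i \<noteq> p (Suc i)" if "i < n" for i using closed_walk_neq[OF inj cl _ that] n by simp
  note facts = simplicial_complex_walk[of p n] walk_complex_card_le walk_complex_connected[of p n]
  have "3 \<le> n" using n by simp
  with inj cl show "vertex_decomposable \<Delta>" "shellable \<Delta>"
    unfolding \<Delta> by (auto intro: vertex_decomposable_cycle shellable_cycle)
  show "cohen_macaulay K \<Delta>" unfolding \<Delta> by (rule cohen_macaulay_dim_1[OF facts])
  show "seq_cohen_macaulay K \<Delta>" unfolding \<Delta>
    by (rule seq_cohen_macaulay_dim_1[OF facts(1,2) walk_complex_face_in_edge facts(3)]) (use ne in auto)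
  show "S2 \<Delta>" unfolding \<Delta> by (rule S2_dim_1[OF facts])
qed

lemma imp_coprime:
  assumes "vertex_decomposable \<Delta> \<or> shellable \<Delta> \<or> cohen_macaulay K \<Delta> \<or>
    seq_cohen_macaulay K \<Delta> \<or> S2 \<Delta>"
  shows "gcd n j = 1"
proof -
  have edge: "{a, nxt a} \<in> \<Delta>" "card {a, nxt a} = 2" if "a < n" for a
    using edge_face[OF that] nxt_neq[of a] by auto
  have facet: "card F \<ge> 2" if "F \<in> facets \<Delta>" for F using facet_card[OF that] by simp
  \<comment> \<open>Index 2 means generated by edges. Sequential Cohen-Macaulayness speaks about
    this skeleton, which contains every vertex, also when \<Delta> consists of triangles.\<close>
  define \<Gamma> where "\<Gamma> = pure_skeleton \<Delta> 2"
  have \<Gamma>: "simplicial_complex \<Gamma>" "\<Gamma> \<subseteq> \<Delta>"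
    using simplicial_complex_pure_skeleton[OF complex] simplicial_complex_subset[OF complex]
    by (auto simp: \<Gamma>_def pure_skeleton_def)
  have e\<Gamma>: "{a, nxt a} \<in> \<Gamma>" if "a < n" for a
    using edge[OF that] by (auto simp: \<Gamma>_def pure_skeleton_def)
  then have v\<Gamma>: "a \<in> \<Union>\<Gamma>" if "a < n" for a using that by blast
  have "0 < n" "1 < n" using n by auto
  have edge2: "2 \<le> card {0, nxt 0}" using edge(2)[OF \<open>0 < n\<close>] by simp
  note \<Delta>_conn = connected_imp_coprime[OF order_refl _ vertices[OF \<open>0 < n\<close>] vertices[OF \<open>1 < n\<close>]]
  consider "vertex_decomposable \<Delta>" | "shellable \<Delta>" | "cohen_macaulay K \<Delta>"
    | "seq_cohen_macaulay K \<Delta>" | "S2 \<Delta>" using assms by blast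
  then show ?thesis
  proof cases
    case 1
    then show ?thesis using vertex_decomposable_imp_connected[OF _ complex facet] \<Delta>_conn by blast
  next
    case 2
    then show ?thesis using shellable_imp_connected[OF _ complex facet] \<Delta>_conn by blast
  next
    case 3
    then show ?thesis
      using cohen_macaulay_imp_connected[OF complex edge(1)[OF \<open>0 < n\<close>] edge2] \<Delta>_conn by blast
  next
    case 4
    then have "cohen_macaulay K \<Gamma>" by (simp add: seq_cohen_macaulay_def \<Gamma>_def)
    then have "complex_connected \<Gamma>"
      using cohen_macaulay_imp_connected[OF \<Gamma>(1) e\<Gamma>[OF \<open>0 < n\<close>] edge2] by blast
    then show ?thesis using connected_imp_coprime[OF \<Gamma>(2)] v\<Gamma> \<open>0 < n\<close> \<open>1 < n\<close> by blast
  next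
    case 5
    then show ?thesis
      using S2_imp_connected[OF complex edge(1)[OF \<open>0 < n\<close>] edge2] \<Delta>_conn by blast
  qed
qed

end

theorem theorem3p7:
  fixes K :: "'k::field itself" and n j :: nat
  assumes "n \<ge> 4" and "1 \<le> j" and "j \<le> n div 2"
  defines "E \<equiv> circ_adj n ({1..n div 2} - {j})"
  defines "\<Delta> \<equiv> ind_complex {0..<n} E"
  defines "k \<equiv> n div gcd n j"
  shows "induced_matching_number {0..<n} E = (if k = 4 then 2 else 1)
     \<and> well_covered {0..<n} E \<and> buchsbaum_graph K {0..<n} E
     \<and> (vertex_decomposable \<Delta> \<longleftrightarrow> gcd n j = 1)
     \<and> (shellable \<Delta> \<longleftrightarrow> gcd n j = 1)
     \<and> (cohen_macaulay K \<Delta> \<longleftrightarrow> gcd n j = 1)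
     \<and> (seq_cohen_macaulay K \<Delta> \<longleftrightarrow> gcd n j = 1)
     \<and> (S2 \<Delta> \<longleftrightarrow> gcd n j = 1)"
proof -
  interpret circulant_minus_jump n j by unfold_locales (use assms(1-3) in auto)
  show ?thesis
    unfolding E_def \<Delta>_def k_def quotient_eq_4_iff
    by (intro conjI iffI induced_matching_number_eq well_covered_circulant buchsbaum_circulant;
        (erule coprime_imp | rule imp_coprime[of K], blast))
qed

end
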